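(* Let $\mathcal H\subseteq 2^V$ be a JM hypergraph, let $H,H'\in\mathcal H$ with $H\cap H'=\emptyset$, and let $S$ be a set with $H\subseteq S\subseteq V\setminus H'$. Then $\mathcal H^+=\mathcal H\cup\{S\}$ is also a JM hypergraph, and $\mathcal G_{\mathcal H^+}=\mathcal G_{\mathcal H}$.
   Context: Let $V=\{1,\dots,n\}$. A hypergraph is a family $\mathcal H\subseteq 2^V$ with $\mathcal H\neq\emptyset$, $\emptyset\notin\mathcal H$, $V=\bigcup_{H\in\mathcal H}H$. The game $NIM_{\mathcal H}$ is played on positions $x\in\mathbb{Z}_{\ge 0}^V$; a move ($H$-move) $x\to x'$ chooses $H\in\mathcal H$ and goes to any $x'\in\mathbb Z_{\ge0}^V$ with $x'_i<x_i$ for $i\in H$ and $x'_i=x_i$ for $i\notin H$. Players alternate; the player who cannot move loses. The Sprague–Grundy function is $\mathcal G_{\mathcal H}(x)=\mathrm{mex}\{\mathcal G_{\mathcal H}(x') : x\to x' \text{ a move}\}$ ($\mathrm{mex}(S)$ = least nonnegative integer not in $S$). The height $h_{\mathcal H}(x)$ is the maximum number of consecutive moves possible from $x$. With $e$ the all-ones vector, $m(x)=\min_{i}x_i$, $y_{\mathcal H}(x)=h_{\mathcal H}(x-m(x)e)+1$, $v_{\mathcal H}(x)=\binom{y_{\mathcal H}(x)}{2}+\big((m(x)-\binom{y_{\mathcal H}(x)}{2}-1)\bmod y_{\mathcal H}(x)\big)$ (residue in $\{0,\dots,y_{\mathcal H}(x)-1\}$), and $f_{\mathcal H}(x)=h_{\mathcal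 H}(x)$ if $m(x)\le\binom{y_{\mathcal H}(x)}{2}$, else $f_{\mathcal H}(x)=v_{\mathcal H}(x)$. $\mathcal H$ is JM if $\mathcal G_{\mathcal H}=f_{\mathcal H}$ on $\mathbb Z_{\ge0}^V$. *)

theory Defs
  imports Complex_Main "HOL-Library.FuncSet"
begin

definition hypergraph :: "'a set \<Rightarrow> 'a set set \<Rightarrow> bool" where
  "hypergraph V \<H> \<longleftrightarrow> \<H> \<noteq> {} \<and> {} \<notin> \<H> \<and> \<Union>\<H> = V"

text \<open>Positions are the functions from \<open>V\<close> to the naturals, taken to be \<open>undefined\<close> outside \<open>V\<close>.\<close>

definition positions :: "'a set \<Rightarrow> ('a \<Rightarrow> nat) set" where
  "positions V = V \<rightarrow>\<^sub>E UNIV"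

text \<open>As the edges lie inside \<open>V\<close>, a move leads from a position to a position
  (lemma \<open>nim_move_positions\<close>).\<close>

definition nim_move :: "'a set set \<Rightarrow> ('a \<Rightarrow> nat) \<Rightarrow> ('a \<Rightarrow> nat) \<Rightarrow> bool" where
  "nim_move \<H> x x' \<longleftrightarrow> (\<exists>H\<in>\<H>. (\<forall>i\<in>H. x' i < x i) \<and> (\<forall>i. i \<notin> H \<longrightarrow> x' i = x i))"

definition mex :: "nat set \<Rightarrow> nat" where
  "mex A = (LEAST k. k \<notin> A)"

text \<open>Recursion along the move relation, which is well-founded when \<open>V\<close> is finite and \<open>\<H>\<close> is a
  hypergraph on \<open>V\<close>; the defining equation is lemma \<open>sprague_grundy_eq\<close>.\<close>

definition sprague_grundy :: "'a set set \<Rightarrow> ('a \<Rightarrow> nat) \<Rightarrow> nat" where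
  "sprague_grundy \<H> =
     wfrec {(x', x). nim_move \<H> x x'} (\<lambda>g x. mex {g x' |x'. nim_move \<H> x x'})"

text \<open>The set of possible lengths is finite and nonempty for a hypergraph on a finite vertex set
  (lemma \<open>finite_play_lengths\<close>), so \<open>Max\<close> is meaningful.\<close>

definition height :: "'a set set \<Rightarrow> ('a \<Rightarrow> nat) \<Rightarrow> nat" where
  "height \<H> x = Max {k. \<exists>x'. (nim_move \<H> ^^ k) x x'}"

definition min_pile :: "'a set \<Rightarrow> ('a \<Rightarrow> nat) \<Rightarrow> nat" where
  "min_pile V x = Min (x ` V)"

text \<open>The subtraction is exact, since \<open>min_pile V x \<le> x i\<close> on \<open>V\<close>.\<close>

definition y_val :: "'a set \<Rightarrow> 'a set set \<Rightarrow> ('a \<Rightarrow> nat) \<Rightarrow> nat" where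
  "y_val V \<H> x = height \<H> (\<lambda>i\<in>V. x i - min_pile V x) + 1"

text \<open>The residue is computed in the integers because the number reduced may be negative.\<close>

definition v_val :: "'a set \<Rightarrow> 'a set set \<Rightarrow> ('a \<Rightarrow> nat) \<Rightarrow> nat" where
  "v_val V \<H> x =
     (y_val V \<H> x choose 2) +
     nat ((int (min_pile V x) - int (y_val V \<H> x choose 2) - 1) mod int (y_val V \<H> x))"

definition f_val :: "'a set \<Rightarrow> 'a set set \<Rightarrow> ('a \<Rightarrow> nat) \<Rightarrow> nat" where
  "f_val V \<H> x =
     (if min_pile V x \<le> (y_val V \<H> x choose 2) then height \<H> x else v_val V \<H> x)"

definition JM :: "'a set \<Rightarrow> 'a set set \<Rightarrow> bool" where
  "JM V \<H> \<longleftrightarrow> (\<forall>x\<in>positions V. sprague_grundy \<H> x = f_val V \<H> x)"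

lemma nim_move_positions:
  assumes "hypergraph V \<H>" "x \<in> positions V" "nim_move \<H> x x'"
  shows "x' \<in> positions V"
proof -
  obtain H where H: "H \<in> \<H>" "\<forall>i. i \<notin> H \<longrightarrow> x' i = x i"
    using assms(3) by (auto simp: nim_move_def)
  have "H \<subseteq> V" using assms(1) H(1) by (auto simp: hypergraph_def)
  with H(2) assms(2) show ?thesis
    by (auto simp: positions_def PiE_def extensional_def)
qed

lemma nim_move_sum_less:
  assumes "finite V" "hypergraph V \<H>" "nim_move \<H> x x'"
  shows "sum x' V < sum x V"
proof -
  obtain H where H: "H \<in> \<H>" "\<forall>i\<in>H. x' i < x i" "\<forall>i. i \<notin> H \<longrightarrow> x' i = x i"
    using assms(3) by (auto simp: nim_move_def)
  have "H \<noteq> {}" using assms(2) H(1) unfolding hypergraph_def by metis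
  then obtain j where j: "j \<in> H" by blast
  have "j \<in> V" using assms(2) H(1) j by (auto simp: hypergraph_def)
  moreover have "x' i \<le> x i" for i using H(2,3) by (cases "i \<in> H") (auto simp: less_imp_le)
  ultimately show ?thesis using assms(1) H(2) j by (intro sum_strict_mono_ex1) auto
qed

lemma wf_nim_move:
  assumes "finite V" "hypergraph V \<H>"
  shows "wf {(x', x). nim_move \<H> x x'}"
  by (rule wf_subset[OF wf_measure[of "\<lambda>x. sum x V"]]) (auto intro: nim_move_sum_less[OF assms])

lemma sprague_grundy_eq:
  assumes "finite V" "hypergraph V \<H>"
  shows "sprague_grundy \<H> x = mex {sprague_grundy \<H> x' |x'. nim_move \<H> x x'}"
proof -
  let ?R = "{(x', x). nim_move \<H> x x'}"
  let ?F = "\<lambda>g x. mex {g x' |x'. nim_move \<H> x x'}"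
  have "sprague_grundy \<H> x = ?F (cut (sprague_grundy \<H>) ?R x) x"
    unfolding sprague_grundy_def by (subst wfrec[OF wf_nim_move[OF assms]]) simp
  also have "{cut (sprague_grundy \<H>) ?R x x' |x'. nim_move \<H> x x'}
      = {sprague_grundy \<H> x' |x'. nim_move \<H> x x'}"
    by (simp add: cut_def cong: conj_cong) metis
  finally show ?thesis .
qed

lemma finite_play_lengths:
  assumes "finite V" "hypergraph V \<H>"
  shows "finite {k. \<exists>x'. (nim_move \<H> ^^ k) x x'}" and "0 \<in> {k. \<exists>x'. (nim_move \<H> ^^ k) x x'}"
proof -
  have "k + sum x' V \<le> sum x V" if "(nim_move \<H> ^^ k) x x'" for k x'
    using that
  proof (induction k arbitrary: x')
    case (Suc k)
    then obtain z where "(nim_move \<H> ^^ k) x z" "nim_move \<H> z x'" by auto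
    then show ?case using Suc.IH[of z] nim_move_sum_less[OF assms, of z x'] by simp
  qed simp
  then have "{k. \<exists>x'. (nim_move \<H> ^^ k) x x'} \<subseteq> {..sum x V}"
    by (auto dest: add_leD1)
  then show "finite {k. \<exists>x'. (nim_move \<H> ^^ k) x x'}"
    by (rule finite_subset) simp
qed auto

end

theory Submission
  imports Defs
begin

text \<open>Every \<open>S\<close>-move is dominated by an \<open>H\<close>-move, so adding \<open>S\<close> changes neither heights nor \<open>f\<close>.
  It remains to see that an \<open>S\<close>-move from \<open>x\<close> to \<open>x'\<close> never preserves \<open>f\<close>: the values below
  \<open>f x\<close> are already attained by the old moves, so the mex does not change. The reason is that the
  move leaves \<open>H'\<close> untouched. Write \<open>m\<close>, \<open>m'\<close> for the two minima. Since every pile on \<open>H'\<close> is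
  still at least \<open>m\<close>, the height of \<open>x'\<close> is at least \<open>m\<close>, whereas \<open>v x < m\<close> whenever \<open>f x = v x\<close>;
  and the height of \<open>x' - m' e\<close> is at least \<open>m - m'\<close>, so \<open>m - m' < y x'\<close>, which rules out
  \<open>m \<equiv> m'\<close> modulo \<open>y x = y x'\<close> unless \<open>m = m'\<close>, and in that case \<open>y\<close> drops.\<close>

lemma mex_notin:
  assumes "finite A"
  shows "mex A \<notin> A"
proof -
  obtain k where "k \<notin> A" using ex_new_if_finite[OF infinite_UNIV_nat assms] by blast
  then show ?thesis unfolding mex_def by (rule LeastI)
qed

text \<open>Used to pass from the old options of a position to the larger set of options that
  includes the \<open>S\<close>-moves.\<close>

lemma mex_superset:
  assumes "A \<subseteq> B" "mex A \<notin> B"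
  shows "mex B = mex A"
proof -
  have "mex A \<le> k" if "k \<notin> B" for k
    using that assms(1) unfolding mex_def by (intro Least_le) blast
  with assms(2) show ?thesis unfolding mex_def[of B] by (intro Least_equality)
qed

text \<open>Piles never grow, so all options lie in a finite box. This makes
  \<open>mex_notin\<close> applicable.\<close>

lemma finite_nim_moves:
  assumes "finite V" "hypergraph V \<H>" "x \<in> positions V"
  shows "finite {x'. nim_move \<H> x x'}"
proof (rule finite_subset)
  show "{x'. nim_move \<H> x x'} \<subseteq> (\<Pi>\<^sub>E i\<in>V. {..x i})"
  proof
    fix x' assume "x' \<in> {x'. nim_move \<H> x x'}"
    then have move: "nim_move \<H> x x'" by simp
    have "x' i \<le> x i" for i
      using move unfolding nim_move_def by (metis le_eq_less_or_eq)
    with nim_move_positions[OF assms(2,3) move] show "x' \<in> (\<Pi>\<^sub>E i\<in>V. {..x i})"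
      by (auto simp: positions_def PiE_def)
  qed
  show "finite (\<Pi>\<^sub>E i\<in>V. {..x i})" using assms(1) by (intro finite_PiE) auto
qed

text \<open>Each move on \<open>E\<close> is imitated on a smaller edge. The imitating play keeps
  every pile at least as large, so it can always continue.\<close>

lemma play_simulation:
  assumes refine: "\<And>E. E \<in> \<H> \<Longrightarrow> \<exists>E'\<in>\<K>. E' \<subseteq> E"
    and "(nim_move \<H> ^^ k) x x'"
  shows "\<exists>z'. (nim_move \<K> ^^ k) x z' \<and> x' \<le> z'"
  using assms(2)
proof (induction k arbitrary: x')
  case (Suc k)
  then obtain u where u: "(nim_move \<H> ^^ k) x u" "nim_move \<H> u x'" by auto
  with Suc.IH obtain w where w: "(nim_move \<K> ^^ k) x w" "u \<le> w" by blast
  obtain E where E: "E \<in> \<H>" "\<forall>i\<in>E. x' i < u i" "\<forall>i. i \<notin> E \<longrightarrow> x' i = u i"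
    using u(2) by (auto simp: nim_move_def)
  obtain E' where E': "E' \<in> \<K>" "E' \<subseteq> E" using refine[OF E(1)] by blast
  \<comment> \<open>The imitation copies the new values on \<open>E'\<close> only.\<close>
  let ?z = "\<lambda>i. if i \<in> E' then x' i else w i"
  have uw: "u i \<le> w i" for i using w(2) by (simp add: le_fun_def)
  have "x' i < w i" if "i \<in> E'" for i using that E(2) E'(2) uw[of i] by fastforce
  then have "nim_move \<K> w ?z" using E'(1) unfolding nim_move_def by (intro bexI[of _ E']) auto
  moreover have "x' i \<le> w i" for i
    using E(2,3) uw[of i] by (cases "i \<in> E") fastforce+
  then have "x' \<le> ?z" by (auto simp: le_fun_def)
  ultimately show ?case using w(1) by auto
qed auto

lemma height_eqI:
  assumes "\<And>E. E \<in> \<H> \<Longrightarrow> \<exists>E'\<in>\<K>. E' \<subseteq> E" "\<And>E. E \<in> \<K> \<Longrightarrow> \<exists>E'\<in>\<H>. E' \<subseteq> E"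
  shows "height \<H> = height \<K>"
proof
  fix x
  have "{k. \<exists>x'. (nim_move \<H> ^^ k) x x'} = {k. \<exists>x'. (nim_move \<K> ^^ k) x x'}"
    using play_simulation[of \<H> \<K>, OF assms(1)] play_simulation[of \<K> \<H>, OF assms(2)] by blast
  then show "height \<H> x = height \<K> x" by (simp add: height_def)
qed

lemma height_ge:
  assumes "finite V" "hypergraph V \<H>" "(nim_move \<H> ^^ k) x x'"
  shows "k \<le> height \<H> x"
  unfolding height_def using assms(3) by (intro Max_ge finite_play_lengths[OF assms(1,2)]) auto

lemma height_attained:
  assumes "finite V" "hypergraph V \<H>"
  obtains x' where "(nim_move \<H> ^^ height \<H> x) x x'"
  using Max_in[OF finite_play_lengths(1)[OF assms, of x]] finite_play_lengths(2)[OF assms, of x]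
  unfolding height_def by blast

lemma height_less:
  assumes "finite V" "hypergraph V \<H>" "nim_move \<H> x x'"
  shows "height \<H> x' < height \<H> x"
proof -
  obtain z where "(nim_move \<H> ^^ height \<H> x') x' z" using height_attained[OF assms(1,2)] .
  with assms(3) have "(nim_move \<H> ^^ Suc (height \<H> x')) x z" by (rule relpowp_Suc_I2)
  from height_ge[OF assms(1,2) this] show ?thesis by simp
qed

text \<open>Removing one token from every pile of \<open>E\<close> can be repeated \<open>k\<close>
  times.\<close>

lemma height_ge_edge:
  assumes "finite V" "hypergraph V \<H>" "E \<in> \<H>" "\<And>i. i \<in> E \<Longrightarrow> k \<le> x i"
  shows "k \<le> height \<H> x"
proof -
  have "(nim_move \<H> ^^ k) x (\<lambda>i. if i \<in> E then x i - k else x i)"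
    using assms(4)
  proof (induction k)
    case (Suc k)
    let ?x = "\<lambda>k i. if i \<in> E then x i - k else x i"
    have "(nim_move \<H> ^^ k) x (?x k)" using Suc by fastforce
    moreover have "nim_move \<H> (?x k) (?x (Suc k))"
      unfolding nim_move_def using assms(3) Suc.prems
      by (intro bexI[of _ E]) (auto simp: Suc_le_eq diff_less_mono2)
    ultimately show ?case by auto
  qed auto
  then show ?thesis by (rule height_ge[OF assms(1,2)])
qed

text \<open>The blocks from \<open>y choose 2\<close> up to \<open>Suc y choose 2\<close>, right end
  excluded, are disjoint for different \<open>y\<close>, so the value of \<open>v\<close> determines
  \<open>y\<close>.\<close>

lemma v_val_bounds:
  "y_val V \<H> x choose 2 \<le> v_val V \<H> x"
  "v_val V \<H> x < Suc (y_val V \<H> x) choose 2"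
proof -
  have "0 < y_val V \<H> x" by (simp add: y_val_def)
  then have "nat (a mod int (y_val V \<H> x)) < y_val V \<H> x" for a by (simp add: nat_less_iff)
  then show "v_val V \<H> x < Suc (y_val V \<H> x) choose 2"
    by (simp add: v_val_def numeral_2_eq_2)
qed (simp add: v_val_def)

lemma v_val_eq:
  assumes "y_val V \<H> x choose 2 < min_pile V x"
  shows "v_val V \<H> x =
    (y_val V \<H> x choose 2) + (min_pile V x - (y_val V \<H> x choose 2) - 1) mod y_val V \<H> x"
proof -
  have "int (min_pile V x) - int (y_val V \<H> x choose 2) - 1
      = int (min_pile V x - (y_val V \<H> x choose 2) - 1)"
    using assms by linarith
  then show ?thesis by (simp only: v_val_def nat_int flip: zmod_int)
qed

lemma v_val_less_min_pile:
  assumes "y_val V \<H> x choose 2 < min_pile V x"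
  shows "v_val V \<H> x < min_pile V x"
  using mod_less_eq_dividend[of "min_pile V x - (y_val V \<H> x choose 2) - 1" "y_val V \<H> x"]
    v_val_eq[OF assms] assms by linarith

text \<open>Stated for a family that contains \<open>S\<close>, so that the \<open>S\<close>-move is
  legal and heights strictly decrease along it.\<close>

lemma f_val_move_neq:
  assumes V: "finite V" and hyp: "hypergraph V \<K>"
    and S: "S \<in> \<K>" and H': "H' \<in> \<K>" "S \<inter> H' = {}"
    and less: "\<And>i. i \<in> S \<Longrightarrow> x' i < x i" and same: "\<And>i. i \<notin> S \<Longrightarrow> x' i = x i"
  shows "f_val V \<K> x' \<noteq> f_val V \<K> x"
proof -
  let ?m = "min_pile V x" and ?m' = "min_pile V x'"
  let ?y = "y_val V \<K> x" and ?y' = "y_val V \<K> x'"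
  have edge_sub: "E \<subseteq> V" if "E \<in> \<K>" for E using hyp that by (auto simp: hypergraph_def)
  have "V \<noteq> {}" using hyp S by (auto simp: hypergraph_def)
  have le: "x' i \<le> x i" for i using less[of i] same[of i] by (cases "i \<in> S") auto
  have m_le: "?m \<le> x i" "?m' \<le> x' i" if "i \<in> V" for i
    using V that by (auto simp: min_pile_def)
  have "?m' \<le> ?m"
    unfolding min_pile_def[of V x] using V \<open>V \<noteq> {}\<close> order_trans[OF m_le(2) le] by simp
  have move: "nim_move \<K> x x'" using S less same by (auto simp: nim_move_def)
  have on_H': "?m \<le> x' i" if "i \<in> H'" for i
  proof -
    have "i \<notin> S" "i \<in> V" using that H'(2) edge_sub[OF H'(1)] by auto
    then show ?thesis using same m_le(1) by simp
  qed
  have h'_ge: "?m \<le> height \<K> x'" using height_ge_edge[OF V hyp H'(1)] on_H' .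
  have h_less: "height \<K> x' < height \<K> x" using height_less[OF V hyp move] .
  \<comment> \<open>With equal minima, subtracting them turns the move into a move between the
    reduced positions.\<close>
  have y_drop: "?y' < ?y" if "?m' = ?m"
  proof -
    have "nim_move \<K> (\<lambda>i\<in>V. x i - ?m) (\<lambda>i\<in>V. x' i - ?m')"
      unfolding nim_move_def
    proof (intro bexI[OF _ S] conjI ballI allI impI)
      fix i assume "i \<in> S"
      then show "(\<lambda>i\<in>V. x' i - ?m') i < (\<lambda>i\<in>V. x i - ?m) i"
        using edge_sub[OF S] less[of i] m_le(2)[of i] that by (auto intro: diff_less_mono)
    next
      fix i assume "i \<notin> S"
      then show "(\<lambda>i\<in>V. x' i - ?m') i = (\<lambda>i\<in>V. x i - ?m) i"
        \<comment> \<open>Outside \<open>V\<close> both sides are \<open>undefined\<close>.\<close>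
        using same[of i] that by (simp add: restrict_def)
    qed
    from height_less[OF V hyp this] show ?thesis by (simp add: y_val_def)
  qed
  have y'_gt: "?m - ?m' < ?y'"
  proof -
    have "?m - ?m' \<le> height \<K> (\<lambda>i\<in>V. x' i - ?m')"
      using on_H' edge_sub[OF H'(1)] by (intro height_ge_edge[OF V hyp H'(1)]) (auto intro: diff_le_mono)
    then show ?thesis by (simp add: y_val_def)
  qed
  \<comment> \<open>\<open>long\<close> means that \<open>f\<close> is the height,
    \<open>short\<close> that it is \<open>v\<close>; the first word refers to \<open>x\<close>, the
    second to \<open>x'\<close>.\<close>
  consider (long_long) "?m \<le> ?y choose 2" "?m' \<le> ?y' choose 2"
    | (long_short) "?m \<le> ?y choose 2" "?y' choose 2 < ?m'"
    | (short_long) "?y choose 2 < ?m" "?m' \<le> ?y' choose 2"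
    | (short_short) "?y choose 2 < ?m" "?y' choose 2 < ?m'"
    by linarith
  then show ?thesis
  proof cases
    case long_long
    with h_less show ?thesis by (simp add: f_val_def)
  next
    case long_short
    \<comment> \<open>The chain is \<open>v x' < m' \<le> m \<le> h x' < h x\<close>.\<close>
    with v_val_less_min_pile[OF long_short(2)] \<open>?m' \<le> ?m\<close> h'_ge h_less
    show ?thesis by (simp add: f_val_def)
  next
    case short_long
    with v_val_less_min_pile[OF short_long(1)] h'_ge show ?thesis by (simp add: f_val_def)
  next
    case short_short
    have "v_val V \<K> x' \<noteq> v_val V \<K> x"
    proof
      assume eq: "v_val V \<K> x' = v_val V \<K> x"
      \<comment> \<open>The common value lies in the blocks of both \<open>?y\<close> and
        \<open>?y'\<close>.\<close>
      have "?y' choose 2 < Suc ?y choose 2" "?y choose 2 < Suc ?y' choose 2"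
        using v_val_bounds[of V \<K> x] v_val_bounds[of V \<K> x'] eq by linarith+
      then have y: "?y' = ?y"
        using binomial_right_mono[of "Suc ?y" ?y' 2] binomial_right_mono[of "Suc ?y'" ?y 2]
        by linarith
      let ?a = "?m - (?y choose 2) - 1" and ?a' = "?m' - (?y choose 2) - 1"
      have "?a mod ?y = ?a' mod ?y"
        using eq v_val_eq[OF short_short(1)] v_val_eq[OF short_short(2)] y by simp
      then have "?y dvd ?a - ?a'"
        using \<open>?m' \<le> ?m\<close> by (simp add: mod_eq_dvd_iff_nat diff_le_mono)
      moreover have "?a - ?a' = ?m - ?m'" using short_short y by simp
      \<comment> \<open>A multiple of \<open>?y\<close> that is smaller than \<open>?y\<close> is
        zero.\<close>
      ultimately have "?m' = ?m" using y'_gt y \<open>?m' \<le> ?m\<close> by (auto dest: nat_dvd_not_less[rotated])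
      with y_drop y show False by simp
    qed
    with short_short show ?thesis by (simp add: f_val_def)
  qed
qed

theorem theorem3p7:
  fixes n :: nat and V :: "nat set" and \<H> :: "nat set set" and H H' S :: "nat set"
  assumes "V = {1..n}"
    and "hypergraph V \<H>" and "JM V \<H>"
    and "H \<in> \<H>" and "H' \<in> \<H>" and "H \<inter> H' = {}"
    and "H \<subseteq> S" and "S \<subseteq> V - H'"
  shows "hypergraph V (\<H> \<union> {S}) \<and> JM V (\<H> \<union> {S}) \<and>
    (\<forall>x\<in>positions V. sprague_grundy (\<H> \<union> {S}) x = sprague_grundy \<H> x)"
proof -
  let ?K = "\<H> \<union> {S}"
  have V: "finite V" using assms(1) by simp
  have hyp: "hypergraph V ?K"
    using assms(2,4,7,8) unfolding hypergraph_def by auto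
  \<comment> \<open>The new edge \<open>S\<close> contains the old edge \<open>H\<close>.\<close>
  have "height ?K = height \<H>" using assms(4,7) by (intro height_eqI) auto
  then have f_eq: "f_val V ?K = f_val V \<H>"
    by (simp add: fun_eq_iff f_val_def v_val_def y_val_def)
  have G_eq: "sprague_grundy \<H> x = f_val V \<H> x" if "x \<in> positions V" for x
    using assms(3) that by (simp add: JM_def)
  \<comment> \<open>The induction runs along moves of the enlarged game, so its hypothesis covers
    old moves and \<open>S\<close>-moves alike.\<close>
  have main: "sprague_grundy ?K x = f_val V \<H> x" if "x \<in> positions V" for x
    using wf_nim_move[OF V hyp] that
  proof (induction x rule: wf_induct_rule)
    case (less x)
    let ?A = "{sprague_grundy \<H> x' |x'. nim_move \<H> x x'}"
    let ?B = "{sprague_grundy ?K x' |x'. nim_move ?K x x'}"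
    have IH: "sprague_grundy ?K x' = f_val V \<H> x'" if "nim_move ?K x x'" for x'
      using less.IH[of x'] that nim_move_positions[OF hyp less.prems that] by simp
    have sub: "nim_move ?K x x'" if "nim_move \<H> x x'" for x'
      using that by (auto simp: nim_move_def)
    have old: "sprague_grundy \<H> x' = sprague_grundy ?K x'" if "nim_move \<H> x x'" for x'
      using G_eq[OF nim_move_positions[OF assms(2) less.prems that]] IH[OF sub[OF that]] by simp
    have mexA: "mex ?A = f_val V \<H> x"
      using sprague_grundy_eq[OF V assms(2), of x] G_eq[OF less.prems] by simp
    have "finite ?A"
      using finite_nim_moves[OF V assms(2) less.prems] by (simp add: setcompr_eq_image)
    have "f_val V \<H> x \<noteq> sprague_grundy ?K x'" if x': "nim_move ?K x x'" for x'
    proof (cases "nim_move \<H> x x'")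
      case True
      with mex_notin[OF \<open>finite ?A\<close>] mexA old[OF True] show ?thesis by auto
    next
      case False
      \<comment> \<open>A move that no old edge allows must be the \<open>S\<close>-move.\<close>
      with x' have "\<forall>i\<in>S. x' i < x i" "\<forall>i. i \<notin> S \<longrightarrow> x' i = x i"
        by (auto simp: nim_move_def)
      then have "f_val V ?K x' \<noteq> f_val V ?K x"
        using assms(5,8) by (intro f_val_move_neq[OF V hyp, of S H']) auto
      with IH[OF x'] f_eq show ?thesis by simp
    qed
    with mexA have "mex ?A \<notin> ?B" by auto
    moreover have "?A \<subseteq> ?B" using old sub by blast
    ultimately have "mex ?B = mex ?A" by (intro mex_superset)
    with sprague_grundy_eq[OF V hyp, of x] mexA show ?case by simp
  qed
  with hyp f_eq G_eq show ?thesis by (simp add: JM_def)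
qed

end
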